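(* Let $d\ge 3$, $k\ge 2$ be integers and let $\{\Omega_n\}_{n\in\mathbb N}$ be a sequence of finite connected $d$-regular graphs which is an expander, is dg-bounded, and has large girth. Let $\Omega=\bigsqcup_n\Omega_n$. Let $N\ge 1$ and let $Aut(F_N)$ be the automorphism group of the free group $F_N$ of rank $N$. Then for every integer $j\ge 1$, for almost every $\alpha\in\mathcal A(\Omega,T^j)$, every group homomorphism $\Gamma_\alpha\to Aut(F_N)$ has finite image.
   Context: Graphs. For a finite connected graph $\Omega$, $|\Omega|$ is the number of vertices and the Cheeger constant is $h(\Omega)=\min_{1\le |A|\le |\Omega|/2}|\partial A|/|A|$, where $A$ ranges over sets of vertices and $\partial A$ is the set of edges between $A$ and its complement. A sequence $\{\Omega_n\}$ of finite connected graphs of uniformly bounded degree is an expander if $|\Omega_n|\to\infty$ and there is $c>0$ with $h(\Omega_n)\ge c$ for all $n$. The girth of a graph is the edge-length of its shortest non-trivial cycle; the diameter is the greatest edge-length distance between two vertices. The sequence has large girth if $\mathrm{girth}(\Omega_n)\to\infty$, and is dg-bounded if there is $D>0$ with $\mathrm{diam}(\Omega_n)\le D\,\mathrm{girth}(\Omega_n)$ for all $n$. Random monster group. $F_k$ is the free group of rank $k$ with symmetric generating set $T$ of size $2k$ (a free basis and its inverses), and $T^j\subset F_k$ is the set of elements of the form $t_1\cdots t_j$ with $t_i\in T$. A symmetric $F_k$-labelling of a graph is a map $\alpha$ from its oriented edges to $F_k$ with $\alpha(e^{-1})=\alpha(e)^{-1}$ for every edge $e$. $\mathcal A(\Omega,T^j)$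 is the set of symmetric $F_k$-labellings of $\Omega$ with values in $T^j$; for $\Omega=\bigsqcup_n\Omega_n$ it is given the product of the uniform probability distributions on the finite sets $\mathcal A(\Omega_n,T^j)$, and "almost every" refers to this probability. For $\alpha\in\mathcal A(\Omega,T^j)$, $\Gamma_\alpha$ is the quotient of $F_k$ by the normal closure of all elements $\alpha(e_1)\cdots\alpha(e_m)$, where $e_1\cdots e_m$ is a closed path in $\Omega$. *)

theory Defs
  imports
    "HOL-Probability.Probability"
    "HOL-Algebra.Coset"
    "HOL-Algebra.Bij"
    "Graph_Theory.Bidirected_Digraph"
    "Graph_Theory.Digraph_Component"
    "Graph_Theory.Shortest_Path"
begin

section \<open>Graphs\<close>

text \<open>
  Graphs are taken in the sense of Serre: a \<open>bidirected_digraph\<close> \<open>G\<close> with arc reversal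
  \<open>arev\<close>, whose arcs are the oriented edges of the graph and whose (geometric) edges are the pairs
  \<open>{e, arev e}\<close>. Here \<open>arev e \<noteq> e\<close> for every arc; multiple edges and loops are not excluded.
  The degree of a vertex is its out-degree, so that a loop contributes two.
\<close>

definition regular :: "nat \<Rightarrow> ('a, 'b) pre_digraph \<Rightarrow> bool" where
  "regular d G \<longleftrightarrow> (\<forall>v\<in>verts G. out_degree G v = d)"

text \<open>An edge between \<open>A\<close> and its complement has exactly one orientation leaving \<open>A\<close>.\<close>

definition edge_boundary :: "('a, 'b) pre_digraph \<Rightarrow> 'a set \<Rightarrow> 'b set" where
  "edge_boundary G A = {e \<in> arcs G. tail G e \<in> A \<and> head G e \<notin> A}"

text \<open>For a finite graph with at least two vertices the infimum is a minimum of real numbers; for a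
  graph with one vertex it is over the empty set, hence \<open>\<infinity>\<close>.\<close>

definition cheeger_constant :: "('a, 'b) pre_digraph \<Rightarrow> ereal" where
  "cheeger_constant G =
     (INF A\<in>{A. A \<subseteq> verts G \<and> 1 \<le> card A \<and> real (card A) \<le> real (card (verts G)) / 2}.
        ereal (real (card (edge_boundary G A)) / real (card A)))"

definition expander :: "(nat \<Rightarrow> ('a, 'b) pre_digraph) \<Rightarrow> bool" where
  "expander G \<longleftrightarrow>
     (\<forall>n. fin_digraph (G n) \<and> Digraph_Component.connected (G n)) \<and>
     (\<exists>b. \<forall>n. \<forall>v\<in>verts (G n). out_degree (G n) v \<le> b) \<and>
     filterlim (\<lambda>n. card (verts (G n))) at_top sequentially \<and>
     (\<exists>c::real. c > 0 \<and> (\<forall>n. ereal c \<le> cheeger_constant (G n)))"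

text \<open>The library notion of a cycle in a digraph includes the closed walks \<open>[e, arev e]\<close>. These are
  the only cycles that traverse some edge in both directions, and they are excluded here.\<close>

definition nontrivial_cycle :: "('a, 'b) pre_digraph \<Rightarrow> ('b \<Rightarrow> 'b) \<Rightarrow> 'b list \<Rightarrow> bool" where
  "nontrivial_cycle G arev p \<longleftrightarrow> pre_digraph.cycle G p \<and> (\<forall>e\<in>set p. arev e \<notin> set p)"

text \<open>The girth of a forest is \<open>\<infinity>\<close>.\<close>

definition girth :: "('a, 'b) pre_digraph \<Rightarrow> ('b \<Rightarrow> 'b) \<Rightarrow> enat" where
  "girth G arev = (INF p\<in>{p. nontrivial_cycle G arev p}. enat (length p))"

definition graph_diameter :: "('a, 'b) pre_digraph \<Rightarrow> ereal" where
  "graph_diameter G = (SUP u\<in>verts G. SUP v\<in>verts G. wf_digraph.\<mu> G (\<lambda>_. 1) u v)"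

definition large_girth :: "(nat \<Rightarrow> ('a, 'b) pre_digraph) \<Rightarrow> (nat \<Rightarrow> 'b \<Rightarrow> 'b) \<Rightarrow> bool" where
  "large_girth G arev \<longleftrightarrow> (\<lambda>n. girth (G n) (arev n)) \<longlonglongrightarrow> \<infinity>"

definition dg_bounded :: "(nat \<Rightarrow> ('a, 'b) pre_digraph) \<Rightarrow> (nat \<Rightarrow> 'b \<Rightarrow> 'b) \<Rightarrow> bool" where
  "dg_bounded G arev \<longleftrightarrow>
     (\<exists>D::real. D > 0 \<and>
        (\<forall>n. graph_diameter (G n) \<le> ereal D * ereal_of_enat (girth (G n) (arev n))))"


section \<open>Free groups\<close>

text \<open>The free group on \<open>X\<close> consists of the reduced words in the letters \<open>(x, True)\<close>, standing for
  \<open>x\<close>, and \<open>(x, False)\<close>, standing for its inverse.\<close>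

fun inv_letter :: "'x \<times> bool \<Rightarrow> 'x \<times> bool" where
  "inv_letter (x, b) = (x, \<not> b)"

definition reduced_word :: "('x \<times> bool) list \<Rightarrow> bool" where
  "reduced_word w \<longleftrightarrow> successively (\<lambda>a b. b \<noteq> inv_letter a) w"

fun cons_cancel :: "'x \<times> bool \<Rightarrow> ('x \<times> bool) list \<Rightarrow> ('x \<times> bool) list" where
  "cons_cancel a [] = [a]"
| "cons_cancel a (b # w) = (if b = inv_letter a then w else a # b # w)"

definition free_group :: "'x set \<Rightarrow> ('x \<times> bool) list monoid" where
  "free_group X =
     \<lparr>carrier = {w. reduced_word w \<and> fst ` set w \<subseteq> X}, mult = (\<lambda>u v. foldr cons_cancel u v), one = []\<rparr>"

lemma inv_letter_inv_letter [simp]: "inv_letter (inv_letter a) = a"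
  by (cases a) auto

lemma inv_letter_neq [simp]: "inv_letter a \<noteq> a" "a \<noteq> inv_letter a"
  by (cases a; auto)+

lemma fst_inv_letter [simp]: "fst (inv_letter a) = fst a"
  by (cases a) auto

lemma reduced_Nil [simp]: "reduced_word []"
  by (simp add: reduced_word_def)

lemma reduced_tl: "reduced_word (a # w) \<Longrightarrow> reduced_word w"
  by (cases w) (auto simp: reduced_word_def)

lemma reduced_cons_cancel: "reduced_word w \<Longrightarrow> reduced_word (cons_cancel a w)"
  by (cases w) (auto simp: reduced_word_def successively_Cons)

lemma reduced_foldr: "reduced_word w \<Longrightarrow> reduced_word (foldr cons_cancel u w)"
  by (induction u) (auto intro: reduced_cons_cancel)

lemma cons_cancel_inv: "reduced_word w \<Longrightarrow> cons_cancel a (cons_cancel (inv_letter a) w) = w"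
  by (cases w rule: list.exhaust[case_names Nil Cons], simp, cases "tl w")
     (auto simp: reduced_word_def successively_Cons)

lemma cons_cancel_reduced: "reduced_word (a # w) \<Longrightarrow> cons_cancel a w = a # w"
  by (cases w) (auto simp: reduced_word_def)

lemma foldr_cons_cancel_Nil: "reduced_word w \<Longrightarrow> foldr cons_cancel w [] = w"
proof (induction w)
  case (Cons a w)
  then show ?case using reduced_tl[of a w] cons_cancel_reduced[of a w] by simp
qed simp

lemma foldr_cons_cancel:
  "reduced_word w \<Longrightarrow> foldr cons_cancel (cons_cancel a u) w = cons_cancel a (foldr cons_cancel u w)"
  by (cases u) (auto simp: cons_cancel_inv reduced_foldr)

lemma foldr_foldr_cons_cancel:
  "reduced_word w \<Longrightarrow>
     foldr cons_cancel (foldr cons_cancel u v) w = foldr cons_cancel u (foldr cons_cancel v w)"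
  by (induction u) (auto simp: foldr_cons_cancel)

lemma foldr_cons_cancel_inverse:
  "reduced_word v \<Longrightarrow> foldr cons_cancel (rev (map inv_letter u)) (foldr cons_cancel u v) = v"
proof (induction u arbitrary: v)
  case (Cons a u)
  then show ?case
    using cons_cancel_inv[of "foldr cons_cancel u v" "inv_letter a"] by (simp add: reduced_foldr)
qed simp

lemma set_cons_cancel: "set (cons_cancel a w) \<subseteq> insert a (set w)"
  by (cases w) auto

lemma set_foldr_cons_cancel: "set (foldr cons_cancel u w) \<subseteq> set u \<union> set w"
  by (induction u) (use set_cons_cancel in \<open>fastforce+\<close>)

lemma group_free_group: "group (free_group X)"
proof (rule groupI)
  fix u v assume "u \<in> carrier (free_group X)" "v \<in> carrier (free_group X)"
  then show "u \<otimes>\<^bsub>free_group X\<^esub> v \<in> carrier (free_group X)"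
    using image_mono[OF set_foldr_cons_cancel[of u v], of fst]
    by (simp add: free_group_def reduced_foldr image_Un) (meson Un_least subset_trans)
next
  fix u assume u: "u \<in> carrier (free_group X)"
  define w where "w = foldr cons_cancel (rev (map inv_letter u)) []"
  have "w \<in> carrier (free_group X)"
    using u set_foldr_cons_cancel[of "rev (map inv_letter u)" "[]"]
    by (fastforce simp: w_def free_group_def reduced_foldr)
  moreover have "w \<otimes>\<^bsub>free_group X\<^esub> u = \<one>\<^bsub>free_group X\<^esub>"
    using u foldr_cons_cancel_inverse[of "[]" u]
    by (simp add: w_def free_group_def foldr_foldr_cons_cancel foldr_cons_cancel_Nil)
  ultimately show "\<exists>w\<in>carrier (free_group X). w \<otimes>\<^bsub>free_group X\<^esub> u = \<one>\<^bsub>free_group X\<^esub>"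
    by blast
qed (auto simp: free_group_def foldr_foldr_cons_cancel)

text \<open>The universal property.\<close>

lemma free_group_hom_ex:
  assumes "group H" and f: "f \<in> X \<rightarrow> carrier H"
  shows "\<exists>\<phi>\<in>hom (free_group X) H. \<forall>x\<in>X. \<phi> [(x, True)] = f x"
proof -
  interpret H: group H by fact
  define l where "l = (\<lambda>(x, b). if b then f x else inv\<^bsub>H\<^esub> f x)"
  define \<phi> where "\<phi> = (\<lambda>w. foldr (\<lambda>a y. l a \<otimes>\<^bsub>H\<^esub> y) w \<one>\<^bsub>H\<^esub>)"
  have l: "l a \<in> carrier H" if "fst a \<in> X" for a
    using that f by (auto simp: l_def split: prod.splits)
  have l_inv: "l (inv_letter a) = inv\<^bsub>H\<^esub> l a" if "fst a \<in> X" for a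
    using that f by (cases a) (auto simp: l_def Pi_iff)
  have \<phi>: "\<phi> w \<in> carrier H" if "fst ` set w \<subseteq> X" for w
    using that by (induction w) (auto simp: \<phi>_def l)
  have push: "\<phi> (cons_cancel a w) = l a \<otimes>\<^bsub>H\<^esub> \<phi> w" if "fst a \<in> X" "fst ` set w \<subseteq> X" for a w
  proof (cases w)
    case (Cons b v)
    show ?thesis
    proof (cases "b = inv_letter a")
      case True
      have "\<phi> w = l b \<otimes>\<^bsub>H\<^esub> \<phi> v" by (simp add: Cons \<phi>_def)
      then show ?thesis
        using that Cons True \<phi>[of v] l[of a] by (simp add: l_inv H.m_assoc[symmetric])
    qed (simp add: Cons \<phi>_def)
  qed (simp add: \<phi>_def)
  have mult: "\<phi> (foldr cons_cancel u v) = \<phi> u \<otimes>\<^bsub>H\<^esub> \<phi> v"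
    if "fst ` set u \<subseteq> X" "fst ` set v \<subseteq> X" for u v
    using that(1)
  proof (induction u)
    case Nil
    then show ?case using \<phi>[OF that(2)] by (simp add: \<phi>_def)
  next
    case (Cons a u)
    have "fst ` set (foldr cons_cancel u v) \<subseteq> X"
      using set_foldr_cons_cancel[of u v] Cons.prems that(2) by fastforce
    then have "\<phi> (foldr cons_cancel (a # u) v) = l a \<otimes>\<^bsub>H\<^esub> (\<phi> u \<otimes>\<^bsub>H\<^esub> \<phi> v)"
      using Cons by (simp add: push)
    also have "\<dots> = (l a \<otimes>\<^bsub>H\<^esub> \<phi> u) \<otimes>\<^bsub>H\<^esub> \<phi> v"
      using Cons.prems that(2) by (simp add: H.m_assoc l \<phi>)
    also have "l a \<otimes>\<^bsub>H\<^esub> \<phi> u = \<phi> (a # u)" by (simp add: \<phi>_def)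
    finally show ?case .
  qed
  have "\<phi> \<in> hom (free_group X) H"
    by (auto simp: hom_def free_group_def mult intro!: \<phi>)
  moreover have "\<phi> [(x, True)] = f x" if "x \<in> X" for x
    using that f by (auto simp: \<phi>_def l_def Pi_iff)
  ultimately show ?thesis by blast
qed

lemma free_group_hom_unique:
  assumes "group H" and \<phi>: "\<phi> \<in> hom (free_group X) H" and \<psi>: "\<psi> \<in> hom (free_group X) H"
    and eq: "\<And>x. x \<in> X \<Longrightarrow> \<phi> [(x, True)] = \<psi> [(x, True)]"
    and w: "w \<in> carrier (free_group X)"
  shows "\<phi> w = \<psi> w"
proof -
  interpret H: group H by fact
  interpret F: group "free_group X" by (rule group_free_group)
  interpret \<phi>: group_hom "free_group X" H \<phi> by unfold_locales (rule \<phi>)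
  interpret \<psi>: group_hom "free_group X" H \<psi> by unfold_locales (rule \<psi>)
  have gen: "[(x, b)] \<in> carrier (free_group X)" if "x \<in> X" for x b
    using that by (simp add: free_group_def reduced_word_def)
  have inv: "inv\<^bsub>free_group X\<^esub> [(x, True)] = [(x, False)]" if "x \<in> X" for x
    by (rule F.inv_equality) (use gen that in \<open>auto simp: free_group_def\<close>)
  have letter: "\<phi> [a] = \<psi> [a]" if "fst a \<in> X" for a
  proof (cases a)
    case (Pair x b)
    then show ?thesis
      using that eq[of x] inv[of x] gen[of x True] \<phi>.hom_inv[of "[(x, True)]"] \<psi>.hom_inv[of "[(x, True)]"]
      by (cases b) auto
  qed
  show ?thesis using w
  proof (induction w)
    case Nil
    then show ?case using \<phi>.hom_one \<psi>.hom_one by (simp add: free_group_def)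
  next
    case (Cons a w)
    have a: "fst a \<in> X" and w: "w \<in> carrier (free_group X)"
      using Cons.prems reduced_tl[of a w] by (auto simp: free_group_def)
    have "a # w = [a] \<otimes>\<^bsub>free_group X\<^esub> w"
      using Cons.prems by (simp add: free_group_def cons_cancel_reduced)
    then show ?case
      using a w gen[of "fst a" "snd a"] Cons.IH letter by simp
  qed
qed

text \<open>A free basis together with its inverses.\<close>

definition sym_gens :: "'x set \<Rightarrow> ('x \<times> bool) list set" where
  "sym_gens X = {[(x, b)] | x b. x \<in> X}"


section \<open>The random monster group\<close>

definition list_mult :: "('g, 'm) monoid_scheme \<Rightarrow> 'g list \<Rightarrow> 'g" where
  "list_mult F xs = foldr (\<otimes>\<^bsub>F\<^esub>) xs \<one>\<^bsub>F\<^esub>"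

definition set_power :: "('g, 'm) monoid_scheme \<Rightarrow> 'g set \<Rightarrow> nat \<Rightarrow> 'g set" where
  "set_power F T j = {list_mult F ts | ts. length ts = j \<and> set ts \<subseteq> T}"

definition normal_closure :: "('g, 'm) monoid_scheme \<Rightarrow> 'g set \<Rightarrow> 'g set" where
  "normal_closure F R = \<Inter> {K. K \<lhd> F \<and> R \<subseteq> K}"

definition sym_labellings ::
    "('g, 'm) monoid_scheme \<Rightarrow> ('a, 'b) pre_digraph \<Rightarrow> ('b \<Rightarrow> 'b) \<Rightarrow> 'g set \<Rightarrow> ('b \<Rightarrow> 'g) set" where
  "sym_labellings F G arev S =
     {\<alpha> \<in> arcs G \<rightarrow>\<^sub>E S. \<forall>e\<in>arcs G. \<alpha> (arev e) = inv\<^bsub>F\<^esub> (\<alpha> e)}"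

text \<open>A labelling of the disjoint union of the graphs \<open>G n\<close> is a family \<open>\<alpha>\<close> of labellings, \<open>\<alpha> n\<close>
  being its restriction to \<open>G n\<close>. Accordingly, the closed paths of the disjoint union are those of
  the graphs \<open>G n\<close>.\<close>

definition labelling_measure ::
    "('g, 'm) monoid_scheme \<Rightarrow> (nat \<Rightarrow> ('a, 'b) pre_digraph) \<Rightarrow> (nat \<Rightarrow> 'b \<Rightarrow> 'b) \<Rightarrow> 'g set
      \<Rightarrow> (nat \<Rightarrow> 'b \<Rightarrow> 'g) measure" where
  "labelling_measure F G arev S =
     (\<Pi>\<^sub>M n\<in>UNIV. uniform_count_measure (sym_labellings F (G n) (arev n) S))"

definition closed_path_labels ::
    "('g, 'm) monoid_scheme \<Rightarrow> (nat \<Rightarrow> ('a, 'b) pre_digraph) \<Rightarrow> (nat \<Rightarrow> 'b \<Rightarrow> 'g) \<Rightarrow> 'g set" where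
  "closed_path_labels F G \<alpha> =
     {list_mult F (map (\<alpha> n) p) | n u p. pre_digraph.awalk (G n) u p u}"

definition monster_group ::
    "('g, 'm) monoid_scheme \<Rightarrow> (nat \<Rightarrow> ('a, 'b) pre_digraph) \<Rightarrow> (nat \<Rightarrow> 'b \<Rightarrow> 'g) \<Rightarrow> 'g set monoid" where
  "monster_group F G \<alpha> = F Mod (normal_closure F (closed_path_labels F G \<alpha>))"

end

theory Submission
  imports Defs
begin

text \<open>
  The target \<open>Aut(F\<^sub>N)\<close> enters only through its countability. The free group \<open>F\<^sub>k\<close> has only
  countably many homomorphisms \<open>\<phi>\<close> into a countable group, so it is enough to fix one \<open>\<phi>\<close> with
  infinite image and to show that for almost every labelling it does not factor through the
  random quotient (lemma \<open>AE_finite_image_hom_monster_group\<close>, for an arbitrary countable target).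

  If \<open>\<phi>\<close> is constant on \<open>T\<^sup>j\<close> then it is constant on \<open>T\<close>, hence sends \<open>T\<close> to one element of order at
  most two, and its image is finite. So \<open>\<phi>\<close> takes two values on \<open>T\<^sup>j\<close>. Every finite graph of minimal
  degree at least two contains a closed path that crosses some edge \<open>e\<close> exactly once. Keeping all
  other labels, at most one value of \<open>\<phi>(\<alpha>(e))\<close> is compatible with \<open>\<phi>\<close> killing that
  path, so that relabelling \<open>e\<close> turns each bad labelling into a good one. At most \<open>|T\<^sup>j|\<close> bad
  labellings produce the same good one, whence the probability that \<open>\<phi>\<close> kills the path is at
  most \<open>|T\<^sup>j| / (|T\<^sup>j| + 1)\<close> (lemma \<open>card_labellings_killing_path\<close>), uniformly in \<open>n\<close>. The labellings
  of different graphs being independent, almost surely some path is not killed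
  (lemma \<open>AE_hom_nontrivial_on_closed_paths\<close>).
\<close>

section \<open>Closed paths crossing an edge exactly once\<close>

text \<open>The tails of the arcs of an infinite walk without backtracking in a finite graph must repeat;
  a repetition at the least possible distance bounds a closed path with distinct tails.\<close>

lemma closed_path_crossing_edge_once:
  fixes G :: "('a, 'b) pre_digraph"
  assumes "bidirected_digraph G arev" and "fin_digraph G" and ne: "verts G \<noteq> {}"
    and deg: "\<And>v. v \<in> verts G \<Longrightarrow> 2 \<le> out_degree G v"
  obtains u e p where "pre_digraph.awalk G u (e # p) u" "e \<in> arcs G" "e \<notin> set p" "arev e \<notin> set p"
proof -
  interpret bidirected_digraph G arev by fact
  interpret fin_digraph G by fact
  have next_arc: "\<exists>f. f \<in> out_arcs G v \<and> f \<noteq> g" if "v \<in> verts G" for v g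
  proof (rule ccontr)
    assume "\<not> ?thesis"
    then have "out_arcs G v \<subseteq> {g}" by auto
    then have "card (out_arcs G v) \<le> 1"
      using card_mono[of "{g}" "out_arcs G v"] by simp
    then show False using deg[OF that] by (simp add: out_degree_def)
  qed
  obtain v0 where "v0 \<in> verts G" using ne by blast
  with next_arc have "\<exists>f. f \<in> arcs G" by fastforce
  then obtain f where
    f: "\<And>i. f i \<in> arcs G" and
    step: "\<And>i. f (Suc i) \<in> out_arcs G (head G (f i)) \<and> f (Suc i) \<noteq> arev (f i)"
    using dependent_nat_choice[of "\<lambda>_ e. e \<in> arcs G"
        "\<lambda>_ e e'. e' \<in> out_arcs G (head G e) \<and> e' \<noteq> arev e"] next_arc
    by (metis head_in_verts in_out_arcs_conv)
  define t where "t i = tail G (f i)" for i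
  have head_f: "head G (f i) = t (Suc i)" for i
    using step[of i] by (simp add: t_def)
  have walk: "awalk (t i) (map f [i..<i + l]) (t (i + l))" for i l
  proof (induction l arbitrary: i)
    case 0
    then show ?case using f by (simp add: awalk_Nil_iff t_def)
  next
    case (Suc l)
    have "map f [i..<i + Suc l] = f i # map f [Suc i..<Suc i + l]"
      by (simp add: upt_conv_Cons del: upt_Suc)
    then show ?case using Suc.IH[of "Suc i"] f by (simp add: awalk_Cons_iff head_f t_def)
  qed
  have "finite (range t)"
    by (rule finite_subset[OF _ finite_verts]) (use f in \<open>auto simp: t_def\<close>)
  then have "\<not> inj t" using finite_imageD[of t UNIV] infinite_UNIV_nat by blast
  then obtain a b where ab: "t a = t b" "a < b" by (metis injI linorder_neqE_nat)
  then have "0 < b - a" "t a = t (a + (b - a))" by auto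
  then have ex: "\<exists>l>0. \<exists>i. t i = t (i + l)" by blast
  define l where "l = (LEAST l. 0 < l \<and> (\<exists>i. t i = t (i + l)))"
  have l: "0 < l \<and> (\<exists>i. t i = t (i + l))"
    unfolding l_def by (rule LeastI_ex) (use ex in blast)
  have least: "l \<le> m" if "0 < m" "t i = t (i + m)" for i m
    unfolding l_def by (rule Least_le) (use that in blast)
  obtain i where i: "t i = t (i + l)" using l by blast
  have dist: "t x \<noteq> t y" if "i \<le> x" "x < y" "y < i + l" for x y
    using least[of "y - x" x] that by auto
  define p where "p = map f [Suc i..<i + l]"
  have fp: "map f [i..<i + l] = f i # p"
    unfolding p_def by (subst upt_conv_Cons) (use l in simp_all)
  have "f i \<notin> set p"
  proof
    assume "f i \<in> set p"
    then obtain x where "Suc i \<le> x" "x < i + l" "f x = f i" by (auto simp: p_def)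
    then show False using dist[of i x] by (simp add: t_def)
  qed
  moreover have "arev (f i) \<notin> set p"
  proof
    assume "arev (f i) \<in> set p"
    then obtain x where x: "Suc i \<le> x" "x < i + l" "f x = arev (f i)" by (auto simp: p_def)
    \<comment> \<open>The reverse of \<open>f i\<close> starts where \<open>f (Suc i)\<close> does; as tails are distinct the two coincide, and
      the walk backtracks.\<close>
    have "t x = t (Suc i)" using x f head_f by (simp add: t_def)
    then have "x = Suc i" using dist[of "Suc i" x] x by (cases "x = Suc i") auto
    then show False using step[of i] x by simp
  qed
  ultimately show ?thesis
    using that[of "t i" "f i" p] walk[of i l] i f fp by simp
qed


section \<open>Labellings for which a homomorphism kills a closed path\<close>

lemma (in group) list_mult_closed: "set xs \<subseteq> carrier G \<Longrightarrow> list_mult G xs \<in> carrier G"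
  by (induction xs) (auto simp: list_mult_def)

lemma (in group) list_mult_append:
  "set xs \<subseteq> carrier G \<Longrightarrow> set ys \<subseteq> carrier G \<Longrightarrow>
     list_mult G (xs @ ys) = list_mult G xs \<otimes> list_mult G ys"
proof (induction xs)
  case (Cons x xs)
  then show ?case
    using list_mult_closed[of xs] list_mult_closed[of ys] by (auto simp: list_mult_def m_assoc)
qed (use list_mult_closed[of ys] in \<open>auto simp: list_mult_def\<close>)

lemma (in group) inv_list_mult:
  "set xs \<subseteq> carrier G \<Longrightarrow> inv (list_mult G xs) = list_mult G (rev (map (m_inv G) xs))"
proof (induction xs)
  case (Cons x xs)
  then have "inv (list_mult G (x # xs)) = list_mult G (rev (map (m_inv G) xs)) \<otimes> inv x"
    using list_mult_closed[of xs] by (simp add: list_mult_def inv_mult_group)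
  also have "\<dots> = list_mult G (rev (map (m_inv G) xs)) \<otimes> list_mult G [inv x]"
    using Cons.prems by (simp add: list_mult_def)
  also have "\<dots> = list_mult G (rev (map (m_inv G) xs) @ [inv x])"
    using Cons.prems by (intro list_mult_append[symmetric]) auto
  finally show ?case by simp
qed (simp add: list_mult_def)

lemma (in group) set_power_subset: "T \<subseteq> carrier G \<Longrightarrow> set_power G T j \<subseteq> carrier G"
  using list_mult_closed by (fastforce simp: set_power_def)

lemma finite_set_power:
  assumes "finite T" shows "finite (set_power F T j)"
proof -
  have "set_power F T j = list_mult F ` {ts. set ts \<subseteq> T \<and> length ts = j}"
    by (auto simp: set_power_def)
  then show ?thesis using finite_lists_length_eq[OF assms] by simp
qed

lemma (in group) inv_in_set_power:
  assumes T: "T \<subseteq> carrier G" "\<And>t. t \<in> T \<Longrightarrow> inv t \<in> T" and s: "s \<in> set_power G T j"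
  shows "inv s \<in> set_power G T j"
proof -
  obtain ts where ts: "s = list_mult G ts" "length ts = j" "set ts \<subseteq> T"
    using s by (auto simp: set_power_def)
  have "inv s = list_mult G (rev (map (m_inv G) ts))"
    using ts T by (simp add: inv_list_mult)
  moreover have "set (rev (map (m_inv G) ts)) \<subseteq> T" using ts T by auto
  ultimately show ?thesis using ts by (force simp: set_power_def)
qed

lemma finite_sym_labellings:
  assumes "finite (arcs G)" "finite S" shows "finite (sym_labellings F G arev S)"
  by (rule finite_subset[OF _ finite_PiE[of "arcs G" "\<lambda>_. S"]])
     (use assms in \<open>auto simp: sym_labellings_def\<close>)

lemma (in group) sym_labellings_update:
  assumes "bidirected_digraph \<Omega> arev" and e: "e \<in> arcs \<Omega>"
    and S: "S \<subseteq> carrier G" "\<And>s. s \<in> S \<Longrightarrow> inv s \<in> S" and s: "s \<in> S"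
    and a: "a \<in> sym_labellings G \<Omega> arev S"
  shows "a(e := s, arev e := inv s) \<in> sym_labellings G \<Omega> arev S"
proof -
  interpret bidirected_digraph \<Omega> arev by fact
  have [simp]: "arev e \<noteq> e" "e \<noteq> arev e" using arev_neq[OF e] by auto
  have inv_inv_s [simp]: "inv (inv s) = s" using S s by auto
  show ?thesis
    using assms e unfolding sym_labellings_def PiE_def extensional_def Pi_def
    by (auto simp: arev_eq_iff)
qed

text \<open>Each labelling for which \<open>\<phi>\<close> kills the path \<open>e # p\<close> is relabelled at \<open>e\<close> by one of \<open>s0\<close> and \<open>s1\<close> that
  changes the value of \<open>\<phi>\<close> there, after which \<open>\<phi>\<close> no longer kills the path. The original labelling is
  recovered from the new one and the former label of \<open>e\<close>, which lies in \<open>S\<close>.\<close>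

lemma card_labellings_killing_path:
  assumes "group F" "group H" and \<phi>: "\<phi> \<in> hom F H"
    and "bidirected_digraph \<Omega> arev" and fin: "finite (arcs \<Omega>)" "finite S"
    and S: "S \<subseteq> carrier F" "\<And>s. s \<in> S \<Longrightarrow> inv\<^bsub>F\<^esub> s \<in> S"
    and nonconst: "s0 \<in> S" "s1 \<in> S" "\<phi> s0 \<noteq> \<phi> s1"
    and p: "set (e # p) \<subseteq> arcs \<Omega>" "e \<notin> set p" "arev e \<notin> set p"
  shows "card {a \<in> sym_labellings F \<Omega> arev S. \<phi> (list_mult F (map a (e # p))) = \<one>\<^bsub>H\<^esub>} * (card S + 1)
           \<le> card (sym_labellings F \<Omega> arev S) * card S"
proof -
  interpret F: group F by fact
  interpret H: group H by fact
  interpret \<phi>: group_hom F H \<phi> by unfold_locales (rule \<phi>)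
  interpret bidirected_digraph \<Omega> arev by fact
  define A where "A = sym_labellings F \<Omega> arev S"
  define E where "E = {a \<in> A. \<phi> (list_mult F (map a (e # p))) = \<one>\<^bsub>H\<^esub>}"
  define s where "s a = (if \<phi> (a e) = \<phi> s0 then s1 else s0)" for a
  define r where "r a = a(e := s a, arev e := inv\<^bsub>F\<^esub> (s a))" for a
  have e: "e \<in> arcs \<Omega>" using p by simp
  have [simp]: "arev e \<noteq> e" "e \<noteq> arev e" using arev_neq[OF e] by auto
  have A_S: "a x \<in> S" if "a \<in> A" "x \<in> arcs \<Omega>" for a x
    using that by (auto simp: A_def sym_labellings_def)
  have s_S: "s a \<in> S" for a using nonconst by (simp add: s_def)
  have r_A: "r a \<in> A" if "a \<in> A" for a
    using F.sym_labellings_update[OF assms(4) e S s_S] that unfolding A_def r_def by blast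
  have \<phi>_path: "\<phi> (list_mult F (map a (e # p))) = \<phi> (a e) \<otimes>\<^bsub>H\<^esub> \<phi> (list_mult F (map a p))"
    and rest: "list_mult F (map a p) \<in> carrier F" if "a \<in> A" for a
  proof -
    show *: "list_mult F (map a p) \<in> carrier F"
      using p A_S[OF that] S by (intro F.list_mult_closed) auto
    show "\<phi> (list_mult F (map a (e # p))) = \<phi> (a e) \<otimes>\<^bsub>H\<^esub> \<phi> (list_mult F (map a p))"
      using * A_S[OF that e] S by (auto simp: list_mult_def)
  qed
  have r_E: "r a \<in> A - E" if a: "a \<in> E" for a
  proof -
    have "a \<in> A" using a by (simp add: E_def)
    have same: "map (r a) p = map a p" using p by (auto simp: r_def)
    have diff: "\<phi> (r a e) \<noteq> \<phi> (a e)" using nonconst by (auto simp: r_def s_def)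
    have "\<phi> (r a e) \<in> carrier H" "\<phi> (a e) \<in> carrier H"
      using A_S[OF r_A[OF \<open>a \<in> A\<close>] e] A_S[OF \<open>a \<in> A\<close> e] S(1) by auto
    moreover have "\<phi> (list_mult F (map a p)) \<in> carrier H"
      using rest[OF \<open>a \<in> A\<close>] by (rule \<phi>.hom_closed)
    ultimately have "\<phi> (r a e) \<otimes>\<^bsub>H\<^esub> \<phi> (list_mult F (map a p))
        \<noteq> \<phi> (a e) \<otimes>\<^bsub>H\<^esub> \<phi> (list_mult F (map a p))"
      using diff by (simp add: H.right_cancel)
    also have "\<phi> (a e) \<otimes>\<^bsub>H\<^esub> \<phi> (list_mult F (map a p)) = \<one>\<^bsub>H\<^esub>"
      using a unfolding \<phi>_path[OF \<open>a \<in> A\<close>, symmetric] by (simp add: E_def)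
    finally have "\<phi> (list_mult F (map (r a) (e # p))) \<noteq> \<one>\<^bsub>H\<^esub>"
      unfolding \<phi>_path[OF r_A[OF \<open>a \<in> A\<close>]] same .
    then show ?thesis using r_A[OF \<open>a \<in> A\<close>] by (simp add: E_def)
  qed
  have inj: "inj_on (\<lambda>a. (r a, a e)) E"
  proof (rule inj_onI, clarify)
    fix a b assume ab: "a \<in> E" "b \<in> E" "r a = r b" "a e = b e"
    have "a x = b x" for x
    proof (cases "x = e \<or> x = arev e")
      case True
      moreover have "a (arev e) = inv\<^bsub>F\<^esub> (a e)" "b (arev e) = inv\<^bsub>F\<^esub> (b e)"
        using ab e by (auto simp: E_def A_def sym_labellings_def)
      ultimately show ?thesis using ab by auto
    next
      case False
      then show ?thesis using fun_cong[OF ab(3), of x] by (simp add: r_def)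
    qed
    then show "a = b" by blast
  qed
  have fin_A: "finite A" unfolding A_def by (rule finite_sym_labellings[OF fin])
  have E_A: "E \<subseteq> A" by (auto simp: E_def)
  have "(\<lambda>a. (r a, a e)) ` E \<subseteq> (A - E) \<times> S"
    using r_E A_S e by (auto simp: E_def)
  then have "card E \<le> card ((A - E) \<times> S)"
    using card_inj_on_le[OF inj] fin_A fin by blast
  also have "\<dots> = (card A - card E) * card S"
    using fin_A E_A by (simp add: card_cartesian_product card_Diff_subset finite_subset)
  finally have "card E * (card S + 1) \<le> ((card A - card E) + card E) * card S"
    unfolding distrib_left distrib_right by simp
  also have "(card A - card E) + card E = card A"
    using card_mono[OF fin_A E_A] by simp
  finally have "card E * (card S + 1) \<le> card A * card S" .
  then show ?thesis by (simp add: E_def A_def)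
qed


section \<open>Independence\<close>

lemma AE_PiM_ex_notin:
  fixes M :: "nat \<Rightarrow> 'a measure"
  assumes M: "\<And>n. prob_space (M n)" and E: "\<And>n. E n \<in> sets (M n)"
    and q: "\<And>n. measure (M n) (E n) \<le> q" "q < 1"
  shows "AE x in PiM UNIV M. \<exists>n. x n \<notin> E n"
proof -
  define B where "B m = prod_emb UNIV M {..<m} (\<Pi>\<^sub>E n\<in>{..<m}. E n)" for m :: nat
  have q0: "0 \<le> q" using q(1)[of 0] measure_nonneg[of "M 0" "E 0"] by linarith
  have B_sets: "B m \<in> sets (PiM UNIV M)" for m
    unfolding B_def by (rule sets_PiM_I) (use E in auto)
  have B_le: "emeasure (PiM UNIV M) (B m) \<le> ennreal (q ^ m)" for m
  proof -
    have "emeasure (PiM UNIV M) (B m) = (\<Prod>n<m. emeasure (M n) (E n))"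
      unfolding B_def by (rule emeasure_PiM_emb) (use M E in auto)
    also have "\<dots> \<le> (\<Prod>n<m. ennreal q)"
    proof (rule prod_mono_ennreal)
      fix n
      interpret prob_space "M n" by (rule M)
      show "emeasure (M n) (E n) \<le> ennreal q"
        using q by (simp add: emeasure_eq_measure ennreal_leI)
    qed
    also have "\<dots> = ennreal (q ^ m)" using q0 by (simp add: ennreal_power)
    finally show ?thesis .
  qed
  define C where "C = (\<Inter>m. B m)"
  have C_sets: "C \<in> sets (PiM UNIV M)" unfolding C_def using B_sets by auto
  have "emeasure (PiM UNIV M) C \<le> ennreal (q ^ m)" for m
    by (rule order_trans[OF emeasure_mono B_le]) (use B_sets in \<open>auto simp: C_def\<close>)
  moreover have "(\<lambda>m. ennreal (q ^ m)) \<longlonglongrightarrow> ennreal 0"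
    using q q0 by (intro tendsto_ennrealI LIMSEQ_power_zero) auto
  ultimately have "emeasure (PiM UNIV M) C \<le> ennreal 0"
    by (intro LIMSEQ_le_const) auto
  then have null: "C \<in> null_sets (PiM UNIV M)" using C_sets by auto
  show ?thesis
    by (rule AE_I'[OF null]) (auto simp: C_def B_def prod_emb_def space_PiM)
qed

lemma AE_hom_nontrivial_on_closed_paths:
  fixes G :: "nat \<Rightarrow> ('a, 'b) pre_digraph"
  assumes F: "group F" and H: "group H" and \<phi>: "\<phi> \<in> hom F H"
    and G: "\<And>n. bidirected_digraph (G n) (arev n)" "\<And>n. fin_digraph (G n)"
      "\<And>n. verts (G n) \<noteq> {}" "\<And>n v. v \<in> verts (G n) \<Longrightarrow> 2 \<le> out_degree (G n) v"
    and S: "finite S" "S \<subseteq> carrier F" "\<And>s. s \<in> S \<Longrightarrow> inv\<^bsub>F\<^esub> s \<in> S"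
    and nonconst: "s0 \<in> S" "s1 \<in> S" "\<phi> s0 \<noteq> \<phi> s1"
  shows "AE \<alpha> in labelling_measure F G arev S. \<exists>x\<in>closed_path_labels F G \<alpha>. \<phi> x \<noteq> \<one>\<^bsub>H\<^esub>"
proof -
  define A where "A n = sym_labellings F (G n) (arev n) S" for n
  have "\<exists>u e p. pre_digraph.awalk (G n) u (e # p) u \<and> e \<in> arcs (G n) \<and> e \<notin> set p \<and> arev n e \<notin> set p" for n
    by (rule closed_path_crossing_edge_once[OF G(1-3)[of n] G(4)[of _ n]]) blast+
  then obtain u e p where c: "\<And>n. pre_digraph.awalk (G n) (u n) (e n # p n) (u n)"
    "\<And>n. e n \<notin> set (p n)" "\<And>n. arev n (e n) \<notin> set (p n)"
    by metis
  define E where "E n = {a \<in> A n. \<phi> (list_mult F (map a (e n # p n))) = \<one>\<^bsub>H\<^esub>}" for n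
  define q where "q = real (card S) / (real (card S) + 1)"
  have fin: "finite (arcs (G n))" for n using G(2)[of n] by (rule fin_digraph.finite_arcs)
  have fin_A: "finite (A n)" for n unfolding A_def by (rule finite_sym_labellings[OF fin S(1)])
  have path: "set (e n # p n) \<subseteq> arcs (G n)" for n
    using c(1)[of n] by (simp add: pre_digraph.awalk_def)
  show ?thesis
  proof (cases "\<exists>n. A n = {}")
    case True
    \<comment> \<open>If some graph has no symmetric labelling then the whole space is empty.\<close>
    then obtain n where "A n = {}" by blast
    then have "space (labelling_measure F G arev S) = {}"
      by (auto simp: labelling_measure_def space_PiM space_uniform_count_measure PiE_eq_empty_iff A_def)
    then show ?thesis by (intro AE_I2) simp
  next
    case False
    have "AE \<alpha> in labelling_measure F G arev S. \<exists>n. \<alpha> n \<notin> E n"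
      unfolding labelling_measure_def
    proof (rule AE_PiM_ex_notin)
      fix n
      show "prob_space (uniform_count_measure (sym_labellings F (G n) (arev n) S))"
        using False fin_A[of n] by (intro prob_space_uniform_count_measure) (auto simp: A_def)
      show "E n \<in> sets (uniform_count_measure (sym_labellings F (G n) (arev n) S))"
        by (auto simp: sets_uniform_count_measure E_def A_def)
      have "card (E n) * (card S + 1) \<le> card (A n) * card S"
        unfolding E_def A_def
        by (rule card_labellings_killing_path[OF F H \<phi> G(1) fin S nonconst path c(2,3)])
      then have "real (card (E n) * (card S + 1)) \<le> real (card (A n) * card S)"
        by (rule of_nat_mono)
      moreover have "0 < card (A n)" using False fin_A by (simp add: card_gt_0_iff)
      ultimately have "real (card (E n)) / real (card (A n)) \<le> q"
        by (simp add: q_def divide_simps algebra_simps)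
      then show "measure (uniform_count_measure (sym_labellings F (G n) (arev n) S)) (E n) \<le> q"
        using fin_A[of n] by (subst measure_uniform_count_measure) (auto simp: A_def E_def)
    qed (simp add: q_def)
    moreover have "AE \<alpha> in labelling_measure F G arev S. \<forall>n. \<alpha> n \<in> A n"
      by (rule AE_I2) (auto simp: labelling_measure_def space_PiM space_uniform_count_measure A_def)
    ultimately show ?thesis
    proof eventually_elim
      case (elim \<alpha>)
      then obtain n where "\<phi> (list_mult F (map (\<alpha> n) (e n # p n))) \<noteq> \<one>\<^bsub>H\<^esub>"
        by (auto simp: E_def)
      then show ?case using c(1)[of n] unfolding closed_path_labels_def by blast
    qed
  qed
qed


section \<open>Homomorphisms from free groups to countable groups\<close>

lemma letter_in_free_group: "x \<in> X \<Longrightarrow> [(x, b)] \<in> carrier (free_group X)"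
  by (simp add: free_group_def reduced_word_def)

lemma inv_letter_free_group: "x \<in> X \<Longrightarrow> inv\<^bsub>free_group X\<^esub> [(x, b)] = [(x, \<not> b)]"
  by (rule group.inv_equality[OF group_free_group])
     (use letter_in_free_group in \<open>auto simp: free_group_def reduced_word_def\<close>)

lemma sym_gens_subset: "sym_gens X \<subseteq> carrier (free_group X)"
  using letter_in_free_group by (auto simp: sym_gens_def)

lemma inv_in_sym_gens: "t \<in> sym_gens X \<Longrightarrow> inv\<^bsub>free_group X\<^esub> t \<in> sym_gens X"
  by (auto simp: sym_gens_def inv_letter_free_group)

lemma finite_sym_gens:
  assumes "finite X" shows "finite (sym_gens X)"
proof -
  have "sym_gens X = (\<lambda>a. [a]) ` (X \<times> UNIV)" by (auto simp: sym_gens_def)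
  then show ?thesis using assms by simp
qed

text \<open>Homomorphisms are functions on the whole type; they are made extensional to be counted.\<close>

lemma countable_hom_free_group:
  assumes "finite X" "group H" "countable (carrier H)"
  shows "countable (hom (free_group X) H \<inter> extensional (carrier (free_group X)))" (is "countable ?P")
proof (rule countable_image_inj_on)
  let ?r = "\<lambda>\<phi>. \<lambda>x\<in>X. \<phi> [(x, True)]"
  have "?r ` ?P \<subseteq> (\<Pi>\<^sub>E x\<in>X. carrier H)"
    using letter_in_free_group by (force simp: hom_def)
  moreover have "countable (\<Pi>\<^sub>E x\<in>X. carrier H)"
    using assms by (intro countable_PiE) auto
  ultimately show "countable (?r ` ?P)" by (rule countable_subset)
  show "inj_on ?r ?P"
  proof (rule inj_onI)
    fix \<phi> \<psi> assume *: "\<phi> \<in> ?P" "\<psi> \<in> ?P" and r: "?r \<phi> = ?r \<psi>"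
    have "\<phi> [(x, True)] = \<psi> [(x, True)]" if "x \<in> X" for x
      using fun_cong[OF r, of x] that by simp
    then have "\<phi> w = \<psi> w" if "w \<in> carrier (free_group X)" for w
      using free_group_hom_unique[OF assms(2)] * that by blast
    then show "\<phi> = \<psi>" using * by (intro extensionalityI[of \<phi> "carrier (free_group X)"]) auto
  qed
qed

lemma countable_AutoGroup_free_group:
  fixes X :: "'x::countable set"
  assumes "finite X"
  shows "countable (carrier (AutoGroup (free_group X)))"
proof -
  have "countable (hom (free_group X) (free_group X) \<inter> extensional (carrier (free_group X)))"
    by (rule countable_hom_free_group[OF assms group_free_group]) auto
  then show ?thesis
    by (rule countable_subset[rotated]) (auto simp: AutoGroup_def auto_def Bij_def)
qed

text \<open>Comparing \<open>t\<^bsup>j\<^esup>\<close> with \<open>s t\<^bsup>j-1\<^esup>\<close>, for letters \<open>s\<close> and \<open>t\<close>, shows that \<open>\<phi>\<close> takes a single value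
  \<open>c\<close> on letters. Since inverses of letters are letters, \<open>c\<close> is its own inverse, and the image of \<open>\<phi>\<close>
  is contained in \<open>{1, c}\<close>.\<close>

lemma finite_image_if_constant_on_set_power:
  assumes H: "group H" and \<phi>: "\<phi> \<in> hom (free_group X) H" and j: "j \<ge> 1"
    and const: "\<And>s t. s \<in> set_power (free_group X) (sym_gens X) j \<Longrightarrow>
      t \<in> set_power (free_group X) (sym_gens X) j \<Longrightarrow> \<phi> s = \<phi> t"
  shows "finite (\<phi> ` carrier (free_group X))"
proof -
  let ?F = "free_group X"
  interpret F: group ?F by (rule group_free_group)
  interpret H: group H by fact
  interpret \<phi>: group_hom ?F H \<phi> by unfold_locales (rule \<phi>)
  have eq: "\<phi> s = \<phi> t" if "s \<in> sym_gens X" "t \<in> sym_gens X" for s t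
  proof -
    define y where "y = list_mult ?F (replicate (j - 1) t)"
    have y: "y \<in> carrier ?F" unfolding y_def
      by (rule F.list_mult_closed) (use that sym_gens_subset in \<open>auto simp: set_replicate_conv_if\<close>)
    have "r \<otimes>\<^bsub>?F\<^esub> y \<in> set_power ?F (sym_gens X) j" if "r \<in> sym_gens X" for r
    proof -
      have "r \<otimes>\<^bsub>?F\<^esub> y = list_mult ?F (r # replicate (j - 1) t)"
        by (simp add: y_def list_mult_def)
      moreover have "length (r # replicate (j - 1) t) = j" using j by simp
      moreover have "set (r # replicate (j - 1) t) \<subseteq> sym_gens X"
        using that \<open>t \<in> sym_gens X\<close> by (auto simp: set_replicate_conv_if)
      ultimately show ?thesis unfolding set_power_def by blast
    qed
    then have "\<phi> (s \<otimes>\<^bsub>?F\<^esub> y) = \<phi> (t \<otimes>\<^bsub>?F\<^esub> y)" using const that by blast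
    moreover have "s \<in> carrier ?F" "t \<in> carrier ?F" using that sym_gens_subset by auto
    ultimately show ?thesis using y by simp
  qed
  show ?thesis
  proof (cases "X = {}")
    case True
    then have "carrier ?F = {[]}" by (auto simp: free_group_def)
    then show ?thesis by simp
  next
    case False
    then obtain x where x: "x \<in> X" by blast
    define c where "c = \<phi> [(x, True)]"
    have letter: "\<phi> [a] = c" if "fst a \<in> X" for a
    proof -
      have "[(fst a, snd a)] \<in> sym_gens X" "[(x, True)] \<in> sym_gens X"
        unfolding sym_gens_def using that x by blast+
      then show ?thesis unfolding c_def prod.collapse by (rule eq)
    qed
    have c: "c \<in> carrier H" using letter_in_free_group[OF x] by (simp add: c_def)
    have "inv\<^bsub>H\<^esub> c = c"
      using \<phi>.hom_inv[OF letter_in_free_group[OF x, of True]] letter[of "(x, False)"] x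
      by (simp add: inv_letter_free_group c_def)
    then have cc: "c \<otimes>\<^bsub>H\<^esub> c = \<one>\<^bsub>H\<^esub>" using H.r_inv[OF c] by simp
    have "\<phi> w \<in> {\<one>\<^bsub>H\<^esub>, c}" if "w \<in> carrier ?F" for w
      using that
    proof (induction w)
      case Nil
      then show ?case using \<phi>.hom_one by (simp add: free_group_def)
    next
      case (Cons a w)
      have a: "fst a \<in> X" and w: "w \<in> carrier ?F"
        using Cons.prems reduced_tl[of a w] by (auto simp: free_group_def)
      have "a # w = [a] \<otimes>\<^bsub>?F\<^esub> w"
        using Cons.prems by (simp add: free_group_def cons_cancel_reduced)
      then have "\<phi> (a # w) = c \<otimes>\<^bsub>H\<^esub> \<phi> w"
        using w letter_in_free_group[OF a, of "snd a"] letter[OF a] by simp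
      then show ?case using Cons.IH[OF w] c cc by auto
    qed
    then have "\<phi> ` carrier ?F \<subseteq> {\<one>\<^bsub>H\<^esub>, c}" by blast
    then show ?thesis by (rule finite_subset) simp
  qed
qed


section \<open>Homomorphisms from the random monster group\<close>

lemma (in group) normal_closure_normal:
  assumes "R \<subseteq> carrier G" shows "normal_closure G R \<lhd> G"
proof -
  have top: "carrier G \<lhd> G" by (simp add: normal_inv_iff subgroup_self)
  then have "subgroup (normal_closure G R) G"
    unfolding normal_closure_def using assms
    by (intro subgroups_Inter) (auto simp: normal_inv_iff)
  then show ?thesis
    by (auto simp: normal_inv_iff normal_closure_def)
qed

lemma subset_normal_closure: "R \<subseteq> normal_closure F R"
  by (auto simp: normal_closure_def)

lemma closed_path_labels_subset:
  assumes F: "group F" and S: "S \<subseteq> carrier F"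
    and \<alpha>: "\<alpha> \<in> space (labelling_measure F G arev S)"
  shows "closed_path_labels F G \<alpha> \<subseteq> carrier F"
proof
  fix x assume "x \<in> closed_path_labels F G \<alpha>"
  then obtain n u p where x: "x = list_mult F (map (\<alpha> n) p)" and p: "pre_digraph.awalk (G n) u p u"
    by (auto simp: closed_path_labels_def)
  have "\<alpha> n \<in> arcs (G n) \<rightarrow> S"
    using \<alpha> by (force simp: labelling_measure_def space_PiM space_uniform_count_measure
        sym_labellings_def)
  moreover have "set p \<subseteq> arcs (G n)" using p by (simp add: pre_digraph.awalk_def)
  ultimately show "x \<in> carrier F"
    unfolding x using S by (intro group.list_mult_closed[OF F]) auto
qed

text \<open>A homomorphism \<open>h\<close> on the quotient is replaced by its composition with the projection, which
  kills the labels of all closed paths and has the same image.\<close>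

lemma AE_finite_image_hom_monster_group:
  fixes G :: "nat \<Rightarrow> ('a, 'b) pre_digraph"
  assumes X: "finite X" and H: "group H" "countable (carrier H)" and j: "j \<ge> 1"
    and G: "\<And>n. bidirected_digraph (G n) (arev n)" "\<And>n. fin_digraph (G n)"
      "\<And>n. verts (G n) \<noteq> {}" "\<And>n v. v \<in> verts (G n) \<Longrightarrow> 2 \<le> out_degree (G n) v"
  shows "AE \<alpha> in labelling_measure (free_group X) G arev (set_power (free_group X) (sym_gens X) j).
      \<forall>h \<in> hom (monster_group (free_group X) G \<alpha>) H.
        finite (h ` carrier (monster_group (free_group X) G \<alpha>))"
proof -
  let ?F = "free_group X"
  define S where "S = set_power ?F (sym_gens X) j"
  interpret F: group ?F by (rule group_free_group)
  have S: "finite S" "S \<subseteq> carrier ?F" "\<And>s. s \<in> S \<Longrightarrow> inv\<^bsub>?F\<^esub> s \<in> S"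
    unfolding S_def using F.inv_in_set_power[OF sym_gens_subset inv_in_sym_gens]
    by (auto intro: finite_set_power finite_sym_gens X subsetD[OF F.set_power_subset[OF sym_gens_subset]])
  define \<Phi> where "\<Phi> = {\<phi> \<in> hom ?F H \<inter> extensional (carrier ?F). infinite (\<phi> ` carrier ?F)}"
  have "countable \<Phi>"
    by (rule countable_subset[OF _ countable_hom_free_group[OF X H]]) (auto simp: \<Phi>_def)
  have "AE \<alpha> in labelling_measure ?F G arev S.
      \<forall>\<phi>\<in>\<Phi>. \<exists>x\<in>closed_path_labels ?F G \<alpha>. \<phi> x \<noteq> \<one>\<^bsub>H\<^esub>"
  proof (rule AE_ball_countable'[OF _ \<open>countable \<Phi>\<close>])
    fix \<phi> assume \<phi>: "\<phi> \<in> \<Phi>"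
    then obtain s0 s1 where "s0 \<in> S" "s1 \<in> S" "\<phi> s0 \<noteq> \<phi> s1"
      using finite_image_if_constant_on_set_power[OF H(1) _ j, of \<phi> X] unfolding \<Phi>_def S_def by blast
    then show "AE \<alpha> in labelling_measure ?F G arev S. \<exists>x\<in>closed_path_labels ?F G \<alpha>. \<phi> x \<noteq> \<one>\<^bsub>H\<^esub>"
      using \<phi> by (intro AE_hom_nontrivial_on_closed_paths[OF group_free_group H(1) _ G S])
        (auto simp: \<Phi>_def)
  qed
  then have "AE \<alpha> in labelling_measure ?F G arev S. \<forall>h \<in> hom (monster_group ?F G \<alpha>) H.
      finite (h ` carrier (monster_group ?F G \<alpha>))"
    using AE_space
  proof eventually_elim
    case (elim \<alpha>)
    show ?case
    proof (rule ballI, rule ccontr)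
      fix h assume h: "h \<in> hom (monster_group ?F G \<alpha>) H"
        and inf: "infinite (h ` carrier (monster_group ?F G \<alpha>))"
      define R where "R = closed_path_labels ?F G \<alpha>"
      define K where "K = normal_closure ?F R"
      have R: "R \<subseteq> carrier ?F"
        unfolding R_def by (rule closed_path_labels_subset[OF group_free_group S(2) elim(2)])
      interpret K: normal K ?F unfolding K_def by (rule F.normal_closure_normal[OF R])
      have mg: "monster_group ?F G \<alpha> = ?F Mod K" by (simp add: monster_group_def K_def R_def)
      define \<phi> where "\<phi> = (\<lambda>x\<in>carrier ?F. h (K #>\<^bsub>?F\<^esub> x))"
      interpret h: group_hom "?F Mod K" H h
        using h H(1) K.factorgroup_is_group by (auto simp: mg group_hom_def group_hom_axioms_def)
      have "(h \<circ> (\<lambda>x. K #>\<^bsub>?F\<^esub> x)) \<in> hom ?F H"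
        by (rule hom_compose[OF K.r_coset_hom_Mod h.homh])
      then have "\<phi> \<in> hom ?F H" by (auto simp: hom_def \<phi>_def)
      moreover have "\<phi> ` carrier ?F = h ` carrier (monster_group ?F G \<alpha>)"
        by (auto simp: \<phi>_def mg carrier_FactGroup image_image)
      ultimately have "\<phi> \<in> \<Phi>" using inf by (auto simp: \<Phi>_def \<phi>_def)
      then obtain x where x: "x \<in> R" "\<phi> x \<noteq> \<one>\<^bsub>H\<^esub>" using elim(1) by (auto simp: R_def)
      have "x \<in> K" using x(1) subset_normal_closure[of R ?F] by (auto simp: K_def)
      then have "K #>\<^bsub>?F\<^esub> x = \<one>\<^bsub>?F Mod K\<^esub>"
        using F.coset_join2[of x K] K.subgroup_axioms K.subset by auto
      then have "\<phi> x = \<one>\<^bsub>H\<^esub>" using x(1) R h.hom_one by (auto simp: \<phi>_def)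
      then show False using x(2) by simp
    qed
  qed
  then show ?thesis unfolding S_def .
qed

theorem corollary1p4:
  fixes d k N :: nat
    and G :: "nat \<Rightarrow> ('a, 'b) pre_digraph"
    and arev :: "nat \<Rightarrow> 'b \<Rightarrow> 'b"
  assumes "d \<ge> 3" and "k \<ge> 2"
    and "\<And>n. bidirected_digraph (G n) (arev n)"
    and "\<And>n. fin_digraph (G n)"
    and "\<And>n. Digraph_Component.connected (G n)"
    and "\<And>n. regular d (G n)"
    and "expander G"
    and "dg_bounded G arev"
    and "large_girth G arev"
    and "N \<ge> 1"
  shows "\<forall>j\<ge>1.
    AE \<alpha> in labelling_measure (free_group {..<k}) G arev
              (set_power (free_group {..<k}) (sym_gens {..<k}) j).
      \<forall>h \<in> hom (monster_group (free_group {..<k}) G \<alpha>) (AutoGroup (free_group {..<N})).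
        finite (h ` carrier (monster_group (free_group {..<k}) G \<alpha>))"
proof (intro allI impI)
  fix j :: nat assume "j \<ge> 1"
  have "verts (G n) \<noteq> {}" for n
    using assms(5)[of n] by (auto simp: connected_def strongly_connected_def mk_symmetric_def)
  moreover have "2 \<le> out_degree (G n) v" if "v \<in> verts (G n)" for n v
    using assms(1) assms(6)[of n] that by (simp add: regular_def)
  ultimately show "AE \<alpha> in labelling_measure (free_group {..<k}) G arev
              (set_power (free_group {..<k}) (sym_gens {..<k}) j).
      \<forall>h \<in> hom (monster_group (free_group {..<k}) G \<alpha>) (AutoGroup (free_group {..<N})).
        finite (h ` carrier (monster_group (free_group {..<k}) G \<alpha>))"
    by (intro AE_finite_image_hom_monster_group group.AutoGroup group_free_group
        countable_AutoGroup_free_group) (use \<open>j \<ge> 1\<close> assms(3,4) in auto)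
qed

end
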